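(* Let $\mathsf{G}=(N,B,w)$ be a strongly connected weighted directed graph with $N=\{1,\dots,n\}$, $n\ge 2$, such that detailed balance $c_iw_{ij}=c_jw_{ji}$ ($i,j\in N$) holds for some $c_1,\dots,c_n>0$, and let $\phi$ be a coupling function satisfying the properties listed in the context. Let $H:\mathbb{R}\to\mathbb{R}$ be a $C^2$ function with derivative $h=H'$, and let $$E(\boldsymbol q)=\sum_{i\in N}c_iH(c_i^{-1}q_i),\qquad q_i=c_ix_i,$$ be the associated sum-separable energy. To every edge $(j,i)\in B$, $j\ne i$, associate the non-linear resistor element with conductance $$r_{ij}^{-1}=c_iw_{ij}\,\frac{\phi(x_j,x_i)}{\frac{\partial E}{\partial q_j}(\boldsymbol q)-\frac{\partial E}{\partial q_i}(\boldsymbol q)}=c_iw_{ij}\,\frac{\phi(x_j,x_i)}{h(x_j)-h(x_i)}.$$ Then each of these resistor elements is strictly passive if and only if $E$ is strictly convex.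
   Context: Graph: $N=\{1,\dots,n\}$ is the node set; $B\subseteq N\times N$ is the set of branches, whose elements are ordered pairs $(j,i)$ denoting an edge from node $j$ to node $i$; $w:B\to\mathbb{R}_{>0}$ is a weighting with $w_{ij}:=w((j,i))$ if $(j,i)\in B$ and $w_{ij}=0$ otherwise. Coupling function: $\phi:\mathbb{R}\times\mathbb{R}\to\mathbb{R}$ is Lipschitz continuous; $\phi(a,b)<0$ if $a<b$, $\phi(a,b)=0$ iff $a=b$, $\phi(a,b)>0$ if $a>b$; $|\phi(a,b)|$ is increasing when $|a-b|$ is increasing (i.e. with one argument fixed, $|\phi|$ increases as the other argument moves further away from it); and $\phi(a,b)=-\phi(b,a)$. The underlying dynamics is $\dot x_i=\sum_{j:(j,i)\in B}w_{ij}\phi(x_j,x_i)$, $i\in N$. Strict passivity: the resistor element on the edge $(j,i)$ is called strictly passive if its resistance $$r_{ij}=\frac{1}{c_iw_{ij}}\,\frac{h(x_j)-h(x_i)}{\phi(x_j,x_i)}$$ (equivalently its conductance $r_{ij}^{-1}$) is positive for all real $x_i\neq x_j$, i.e. energy is dissipated across an edge connecting two non-identical potentials. In particular, a resistor whose resistance vanishes or is negative for some $x_i\ne x_j$ is not strictly passive. *)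

theory Defs
  imports "HOL-Analysis.Analysis" "Graph_Theory.Graph_Theory"
begin

text \<open>
  The node set is the finite type \<open>'n\<close>. A branch \<open>(j, i)\<close> is an edge from node \<open>j\<close> to node \<open>i\<close>,
  and \<open>branch_weight B w i j\<close> is $w_{ij}$: the first index is the head of the branch.
\<close>

definition branch_weight :: "('n \<times> 'n) set \<Rightarrow> ('n \<times> 'n \<Rightarrow> real) \<Rightarrow> 'n \<Rightarrow> 'n \<Rightarrow> real" where
  "branch_weight B w i j = (if (j, i) \<in> B then w (j, i) else 0)"

definition weighted_strongly_connected :: "('n \<times> 'n) set \<Rightarrow> ('n \<times> 'n \<Rightarrow> real) \<Rightarrow> bool" where
  "weighted_strongly_connected B w \<longleftrightarrow>
     (\<forall>e\<in>B. 0 < w e) \<and> strongly_connected (with_proj \<lparr>pverts = UNIV, parcs = B\<rparr>)"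

definition detailed_balance ::
    "('n::finite \<times> 'n) set \<Rightarrow> ('n \<times> 'n \<Rightarrow> real) \<Rightarrow> real ^ 'n \<Rightarrow> bool" where
  "detailed_balance B w c \<longleftrightarrow>
     (\<forall>i j. c $ i * branch_weight B w i j = c $ j * branch_weight B w j i)"

text \<open>
  Monotonicity of \<open>\<bar>\<phi>\<bar>\<close>: with one argument fixed, moving the other one further away from it, on
  the same side, does not decrease \<open>\<bar>\<phi>\<bar>\<close>. Saturating couplings are thus allowed.
\<close>

definition coupling_function :: "(real \<Rightarrow> real \<Rightarrow> real) \<Rightarrow> bool" where
  "coupling_function \<phi> \<longleftrightarrow>
     (\<exists>L. L-lipschitz_on UNIV (\<lambda>(a, b). \<phi> a b)) \<and>
     (\<forall>a b. a < b \<longrightarrow> \<phi> a b < 0) \<and>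
     (\<forall>a b. \<phi> a b = 0 \<longleftrightarrow> a = b) \<and>
     (\<forall>a b. a > b \<longrightarrow> \<phi> a b > 0) \<and>
     (\<forall>a a' b. b \<le> a \<and> a \<le> a' \<or> a' \<le> a \<and> a \<le> b \<longrightarrow>
        \<bar>\<phi> a b\<bar> \<le> \<bar>\<phi> a' b\<bar> \<and> \<bar>\<phi> b a\<bar> \<le> \<bar>\<phi> b a'\<bar>) \<and>
     (\<forall>a b. \<phi> a b = - \<phi> b a)"

definition strictly_convex_on :: "'a::real_vector set \<Rightarrow> ('a \<Rightarrow> real) \<Rightarrow> bool" where
  "strictly_convex_on S f \<longleftrightarrow> convex S \<and>
     (\<forall>x\<in>S. \<forall>y\<in>S. \<forall>t. x \<noteq> y \<and> 0 < t \<and> t < 1 \<longrightarrow>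
        f ((1 - t) *\<^sub>R x + t *\<^sub>R y) < (1 - t) * f x + t * f y)"

definition partial_derivative :: "(real ^ 'n \<Rightarrow> real) \<Rightarrow> 'n::finite \<Rightarrow> real ^ 'n \<Rightarrow> real" where
  "partial_derivative f k q = deriv (\<lambda>t. f (q + t *\<^sub>R axis k 1)) 0"

definition energy :: "real ^ 'n \<Rightarrow> (real \<Rightarrow> real) \<Rightarrow> real ^ 'n::finite \<Rightarrow> real" where
  "energy c H q = (\<Sum>i\<in>UNIV. c $ i * H (inverse (c $ i) * q $ i))"

definition charge :: "real ^ 'n \<Rightarrow> real ^ 'n \<Rightarrow> real ^ 'n::finite" where
  "charge c x = (\<chi> i. c $ i * x $ i)"

text \<open>
  The resistor on the branch \<open>(j, i)\<close>, at the state \<open>x\<close>. Where the two potentials coincide although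
  \<open>x $ i \<noteq> x $ j\<close>, the resistance vanishes; the conductance, infinite on paper, is then \<open>0\<close> by
  the convention for division by zero, so that it fails to be positive exactly when the
  resistance does.
\<close>

definition edge_conductance ::
    "('n::finite \<times> 'n) set \<Rightarrow> ('n \<times> 'n \<Rightarrow> real) \<Rightarrow> real ^ 'n \<Rightarrow> (real \<Rightarrow> real \<Rightarrow> real) \<Rightarrow>
     (real ^ 'n \<Rightarrow> real) \<Rightarrow> 'n \<Rightarrow> 'n \<Rightarrow> real ^ 'n \<Rightarrow> real" where
  "edge_conductance B w c \<phi> E i j x =
     c $ i * branch_weight B w i j *
     (\<phi> (x $ j) (x $ i) /
      (partial_derivative E j (charge c x) - partial_derivative E i (charge c x)))"

definition edge_resistance ::
    "('n::finite \<times> 'n) set \<Rightarrow> ('n \<times> 'n \<Rightarrow> real) \<Rightarrow> real ^ 'n \<Rightarrow> (real \<Rightarrow> real \<Rightarrow> real) \<Rightarrow>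
     (real ^ 'n \<Rightarrow> real) \<Rightarrow> 'n \<Rightarrow> 'n \<Rightarrow> real ^ 'n \<Rightarrow> real" where
  "edge_resistance B w c \<phi> E i j x =
     1 / (c $ i * branch_weight B w i j) *
     ((partial_derivative E j (charge c x) - partial_derivative E i (charge c x)) /
      \<phi> (x $ j) (x $ i))"

lemma edge_conductance_eq_inverse_resistance:
  "edge_conductance B w c \<phi> E i j x = inverse (edge_resistance B w c \<phi> E i j x)"
  by (simp add: edge_conductance_def edge_resistance_def divide_inverse)

definition strictly_passive ::
    "('n::finite \<times> 'n) set \<Rightarrow> ('n \<times> 'n \<Rightarrow> real) \<Rightarrow> real ^ 'n \<Rightarrow> (real \<Rightarrow> real \<Rightarrow> real) \<Rightarrow>
     (real ^ 'n \<Rightarrow> real) \<Rightarrow> 'n \<Rightarrow> 'n \<Rightarrow> bool" where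
  "strictly_passive B w c \<phi> E i j \<longleftrightarrow>
     (\<forall>x. x $ i \<noteq> x $ j \<longrightarrow> 0 < edge_resistance B w c \<phi> E i j x)"

lemma strictly_passive_iff_conductance:
  "strictly_passive B w c \<phi> E i j \<longleftrightarrow>
     (\<forall>x. x $ i \<noteq> x $ j \<longrightarrow> 0 < edge_conductance B w c \<phi> E i j x)"
  by (simp add: strictly_passive_def edge_conductance_eq_inverse_resistance)

end

(* Strict passivity of one proper resistor already says that h is strictly increasing, since the
   potentials at its two end nodes are arbitrary. Convexity of E corresponds to that of H by
   restricting E to the line spanned by c, where it is a positive multiple of H. *)

theory Submission
  imports Defs
begin

section \<open>Strict convexity on the real line\<close>

lemma strictly_convex_onD:
  assumes "strictly_convex_on S f" "x \<in> S" "y \<in> S" "x \<noteq> y" "0 < t" "t < 1"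
  shows "f ((1 - t) *\<^sub>R x + t *\<^sub>R y) < (1 - t) * f x + t * f y"
  using assms unfolding strictly_convex_on_def by blast

text \<open>Both directions pass through the strict tangent inequality
  \<open>h x * (y - x) < H y - H x\<close> for \<open>x \<noteq> y\<close>. It comes from strict
  convexity via midpoints and from strict monotonicity of \<open>h\<close> via the mean value
  theorem.\<close>

lemma strictly_convex_iff_strict_mono_deriv:
  fixes H h :: "real \<Rightarrow> real"
  assumes H: "\<And>x. (H has_real_derivative h x) (at x)"
  shows "strictly_convex_on UNIV H \<longleftrightarrow> strict_mono h"
proof
  assume sc: "strictly_convex_on UNIV H"
  note conv = strictly_convex_onD[OF sc UNIV_I UNIV_I]
  have mid: "H ((x + y) / 2) < (H x + H y) / 2" if "x \<noteq> y" for x y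
    using conv[OF that, of "1/2"] by (simp add: add_divide_distrib)
  have "convex_on UNIV H"
  proof (rule convex_onI)
    fix t x y :: real
    assume "0 < t" "t < 1"
    then show "H ((1 - t) *\<^sub>R x + t *\<^sub>R y) \<le> (1 - t) * H x + t * H y"
      using conv[of x y t] by (cases "x = y") (auto simp: algebra_simps intro: less_imp_le)
  qed simp
  then have tangent: "H y - H x \<ge> h x * (y - x)" for x y
    using H by (intro convex_on_imp_above_tangent[of UNIV]) auto
  \<comment> \<open>The weak tangent bound is applied at the midpoint, where the increment is half
    of \<open>y - x\<close>. There \<open>H\<close> lies strictly below the mean of its end values,
    and this gap makes the bound at \<open>y\<close> strict.\<close>
  have strict_tangent: "H y - H x > h x * (y - x)" if "x \<noteq> y" for x y
  proof -
    have "(x + y) / 2 - x = (y - x) / 2"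
      by (simp add: field_simps)
    then have "h x * (y - x) / 2 \<le> H ((x + y) / 2) - H x"
      using tangent[where x = x and y = "(x + y) / 2"] by simp
    then have "h x * (y - x) / 2 < (H x + H y) / 2 - H x"
      using mid[OF that] by (rule order.strict_trans1[OF _ diff_strict_right_mono])
    then show ?thesis
      by (simp add: field_simps)
  qed
  show "strict_mono h"
  proof (rule strict_monoI)
    fix x y :: real
    assume "x < y"
    \<comment> \<open>The strict tangent inequalities at \<open>x\<close> and at \<open>y\<close>
      are added; the values of \<open>H\<close> cancel.\<close>
    then have "(h y - h x) * (y - x) > 0"
      using strict_tangent[of x y] strict_tangent[of y x] by (simp add: algebra_simps)
    with \<open>x < y\<close> show "h x < h y"
      by (simp add: zero_less_mult_iff)
  qed
next
  assume mono: "strict_mono h"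
  have tangent: "h x * (y - x) < H y - H x" if "x \<noteq> y" for x y
  proof (cases "x < y")
    case True
    then obtain z where "x < z" "H y - H x = (y - x) * h z"
      using MVT2[of x y H h] H by blast
    with True show ?thesis
      using strict_monoD[OF mono, of x z] by (simp add: mult.commute)
  next
    case False
    with that have "y < x" by simp
    then obtain z where "z < x" "H x - H y = (x - y) * h z"
      using MVT2[of y x H h] H by blast
    moreover have "(x - y) * h z < (x - y) * h x"
      using strict_monoD[OF mono \<open>z < x\<close>] \<open>y < x\<close> by simp
    ultimately show ?thesis
      by (simp add: algebra_simps)
  qed
  show "strictly_convex_on UNIV H"
    unfolding strictly_convex_on_def
  proof (intro conjI ballI allI impI)
    fix x y t :: real
    assume t: "x \<noteq> y \<and> 0 < t \<and> t < 1"
    define z where "z = (1 - t) *\<^sub>R x + t *\<^sub>R y"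
    have xz: "x - z = t * (x - y)" and yz: "y - z = (1 - t) * (y - x)"
      by (simp_all add: z_def algebra_simps)
    have ne: "z \<noteq> x" "z \<noteq> y"
      using xz yz t by auto
    \<comment> \<open>The tangent at the intermediate point \<open>z\<close> lies below
      \<open>H\<close> at both ends. With weights \<open>1 - t\<close> and \<open>t\<close> its
      linear terms cancel, because \<open>z\<close> is the barycentre of \<open>x\<close> and
      \<open>y\<close>.\<close>
    have "(1 - t) * (h z * (x - z)) < (1 - t) * (H x - H z)"
      "t * (h z * (y - z)) < t * (H y - H z)"
      using t tangent[OF ne(1)] tangent[OF ne(2)] by simp_all
    moreover have "(1 - t) * (h z * (x - z)) + t * (h z * (y - z)) = 0"
      unfolding xz yz by (simp add: algebra_simps)
    ultimately show "H ((1 - t) *\<^sub>R x + t *\<^sub>R y) < (1 - t) * H x + t * H y"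
      unfolding z_def[symmetric] by (simp add: algebra_simps)
  qed simp
qed

section \<open>Gradient and convexity of the sum-separable energy\<close>

lemma partial_derivative_energy:
  fixes c q :: "real ^ 'n::finite"
  assumes "\<And>i. c $ i > 0" and H: "\<And>x. (H has_real_derivative h x) (at x)"
  shows "partial_derivative (energy c H) k q = h (q $ k / c $ k)"
proof -
  \<comment> \<open>Moving along axis \<open>k\<close> changes only the summand of index
    \<open>k\<close>. The inner derivative \<open>inverse (c $ k)\<close> from the chain rule
    cancels the weight \<open>c $ k\<close>.\<close>
  have "((\<lambda>s. c $ i * H (inverse (c $ i) * (q + s *\<^sub>R axis k 1) $ i)) has_real_derivative
      (if i = k then h (q $ k / c $ k) else 0)) (at 0)" for i
  proof (cases "i = k")
    case True
    have "c $ k * (h (inverse (c $ k) * (q $ k + 0)) * inverse (c $ k)) = h (q $ k / c $ k)"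
      using assms(1)[of k] by (simp add: divide_inverse mult.commute[of _ "inverse (c $ k)"])
    moreover have "((\<lambda>s. c $ k * H (inverse (c $ k) * (q $ k + s))) has_real_derivative
        c $ k * (h (inverse (c $ k) * (q $ k + 0)) * inverse (c $ k))) (at 0)"
      by (rule DERIV_cmult DERIV_chain2[OF H] derivative_eq_intros refl | simp)+
    ultimately show ?thesis
      using True by (simp add: axis_def)
  next
    case False
    then show ?thesis
      by (simp add: axis_def)
  qed
  then have "((\<lambda>s. energy c H (q + s *\<^sub>R axis k 1)) has_real_derivative
      (\<Sum>i\<in>UNIV. if i = k then h (q $ k / c $ k) else 0)) (at 0)"
    unfolding energy_def by (intro DERIV_sum) auto
  then show ?thesis
    unfolding partial_derivative_def by (simp add: DERIV_imp_deriv)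
qed

text \<open>From \<open>H\<close> to the energy, the convexity inequalities of \<open>H\<close> in
  the rescaled coordinates are summed with the positive weights \<open>c $ i\<close>. Coordinates
  where the two points agree give only equality, but distinct points differ in some coordinate, and
  that one makes the sum strict.\<close>

lemma strictly_convex_energy_iff:
  fixes c :: "real ^ 'n::finite"
  assumes c: "\<And>i. c $ i > 0"
  shows "strictly_convex_on UNIV (energy c H) \<longleftrightarrow> strictly_convex_on UNIV H"
proof
  assume sc: "strictly_convex_on UNIV (energy c H)"
  let ?C = "\<Sum>i\<in>UNIV. c $ i"
  have C: "?C > 0"
    using c by (intro sum_pos) auto
  \<comment> \<open>At \<open>a *\<^sub>R c\<close> every rescaled coordinate equals
    \<open>a\<close>, so all summands share the factor \<open>H a\<close>.\<close>
  have diag: "energy c H (a *\<^sub>R c) = ?C * H a" for a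
  proof -
    have "inverse (c $ i) * (a *\<^sub>R c) $ i = a" for i
      using c[of i] by simp
    then show ?thesis
      unfolding energy_def by (simp only: sum_distrib_right)
  qed
  show "strictly_convex_on UNIV H"
    unfolding strictly_convex_on_def
  proof (intro conjI ballI allI impI)
    fix x y t :: real
    assume t: "x \<noteq> y \<and> 0 < t \<and> t < 1"
    have "c \<noteq> 0"
      using c by (metis less_irrefl zero_index)
    then have "x *\<^sub>R c \<noteq> y *\<^sub>R c"
      using t by simp
    then have "energy c H ((1 - t) *\<^sub>R x *\<^sub>R c + t *\<^sub>R y *\<^sub>R c)
        < (1 - t) * energy c H (x *\<^sub>R c) + t * energy c H (y *\<^sub>R c)"
      using t by (intro strictly_convex_onD[OF sc]) auto
    moreover have "(1 - t) *\<^sub>R x *\<^sub>R c + t *\<^sub>R y *\<^sub>R c = ((1 - t) *\<^sub>R x + t *\<^sub>R y) *\<^sub>R c"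
      by (simp add: scaleR_add_left)
    ultimately have "?C * H ((1 - t) *\<^sub>R x + t *\<^sub>R y) < ?C * ((1 - t) * H x + t * H y)"
      by (simp only: diag) (simp add: algebra_simps)
    with C show "H ((1 - t) *\<^sub>R x + t *\<^sub>R y) < (1 - t) * H x + t * H y"
      by simp
  qed simp
next
  assume sc: "strictly_convex_on UNIV H"
  show "strictly_convex_on UNIV (energy c H)"
    unfolding strictly_convex_on_def
  proof (intro conjI ballI allI impI)
    fix p q :: "real ^ 'n" and t :: real
    assume t: "p \<noteq> q \<and> 0 < t \<and> t < 1"
    let ?a = "\<lambda>i. inverse (c $ i) * p $ i" and ?b = "\<lambda>i. inverse (c $ i) * q $ i"
    let ?l = "\<lambda>i. c $ i * H (inverse (c $ i) * ((1 - t) *\<^sub>R p + t *\<^sub>R q) $ i)"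
    let ?r = "\<lambda>i. c $ i * ((1 - t) * H (?a i) + t * H (?b i))"
    \<comment> \<open>Rescaling a coordinate is linear, hence commutes with convex
      combinations.\<close>
    have l: "?l i = c $ i * H ((1 - t) *\<^sub>R ?a i + t *\<^sub>R ?b i)" for i
      by (simp add: algebra_simps)
    have lt: "?l i < ?r i" if "p $ i \<noteq> q $ i" for i
    proof -
      have "?a i \<noteq> ?b i"
        using that c[of i] by simp
      then show ?thesis
        using strictly_convex_onD[OF sc UNIV_I UNIV_I] t c[of i]
        unfolding l by (intro mult_strict_left_mono) auto
    qed
    have le: "?l i \<le> ?r i" for i
    proof (cases "p $ i = q $ i")
      case True
      then show ?thesis
        by (simp add: algebra_simps)
    next
      case False
      then show ?thesis
        by (rule less_imp_le[OF lt])
    qed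
    obtain k where "p $ k \<noteq> q $ k"
      using t by (metis vec_eq_iff)
    then have "(\<Sum>i\<in>UNIV. ?l i) < (\<Sum>i\<in>UNIV. ?r i)"
      using lt le by (intro sum_strict_mono_ex1) auto
    also have "(\<Sum>i\<in>UNIV. ?r i) = (1 - t) * energy c H p + t * energy c H q"
      by (simp add: energy_def sum_distrib_left sum.distrib[symmetric] algebra_simps)
    finally show "energy c H ((1 - t) *\<^sub>R p + t *\<^sub>R q) < (1 - t) * energy c H p + t * energy c H q"
      by (simp add: energy_def)
  qed simp
qed

section \<open>Proper branches and their resistors\<close>

text \<open>A walk between two distinct nodes cannot consist of self-loops alone.\<close>

lemma strongly_connected_imp_proper_branch:
  fixes B :: "('n::finite \<times> 'n) set"
  assumes "CARD('n) \<ge> 2"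
    and sc: "strongly_connected (with_proj \<lparr>pverts = UNIV, parcs = B\<rparr>)"
  obtains i j where "(j, i) \<in> B" "j \<noteq> i"
proof -
  let ?G = "with_proj \<lparr>pverts = UNIV, parcs = B\<rparr>"
  obtain u v :: 'n where "u \<noteq> v"
    using assms(1) card_2_iff' ex_card[of 2 "UNIV :: 'n set"] by metis
  have "u \<rightarrow>\<^sup>*\<^bsub>?G\<^esub> v"
    using sc by (auto simp: strongly_connected_def)
  \<comment> \<open>Induction along the walk: when one arc is split off, either the rest still joins
    distinct nodes or that arc is itself proper.\<close>
  then have "\<exists>i j. (j, i) \<in> B \<and> j \<noteq> i"
    using \<open>u \<noteq> v\<close> unfolding reachable_def
    by (induction rule: rtrancl_on.induct) (auto simp: arcs_ends_def arc_to_ends_def)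
  with that show ?thesis
    by blast
qed

text \<open>Since \<open>\<phi> (x $ j) (x $ i)\<close> has the sign of
  \<open>x $ j - x $ i\<close>, positive resistance means that \<open>h (x $ j) - h (x $ i)\<close>
  has this sign too. A vanishing difference gives resistance zero, which is not positive, so the
  monotonicity obtained is strict.\<close>

lemma strictly_passive_energy_iff:
  fixes c :: "real ^ 'n::finite"
  assumes c: "\<And>i. c $ i > 0" and w: "w (j, i) > 0"
    and e: "(j, i) \<in> B" "j \<noteq> i"
    and \<phi>: "coupling_function \<phi>"
    and H: "\<And>x. (H has_real_derivative h x) (at x)"
  shows "strictly_passive B w c \<phi> (energy c H) i j \<longleftrightarrow> strict_mono h"
proof -
  have pd: "partial_derivative (energy c H) k (charge c x) = h (x $ k)" for k x
    using c[of k] by (simp add: partial_derivative_energy[OF c H] charge_def)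
  have "1 / (c $ i * branch_weight B w i j) > 0"
    using c[of i] w e by (simp add: branch_weight_def)
  \<comment> \<open>The positive factor in front of the quotient does not affect its sign.\<close>
  then have res: "0 < edge_resistance B w c \<phi> (energy c H) i j x
      \<longleftrightarrow> 0 < (h (x $ j) - h (x $ i)) / \<phi> (x $ j) (x $ i)" for x
    unfolding edge_resistance_def pd
    by (rule mult_less_cancel_left_pos[where a = 0, unfolded mult_zero_right])
  have pos: "a > b \<Longrightarrow> \<phi> a b > 0" and neg: "a < b \<Longrightarrow> \<phi> a b < 0" for a b
    using \<phi> unfolding coupling_function_def by blast+
  show ?thesis
  proof
    assume sp: "strictly_passive B w c \<phi> (energy c H) i j"
    show "strict_mono h"
    proof (rule strict_monoI)
      fix a b :: real
      assume "a < b"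
      \<comment> \<open>As \<open>j \<noteq> i\<close>, the states at the two ends of the branch can
        be prescribed independently; the value at the other nodes is immaterial.\<close>
      define x where "x = (\<chi> k. if k = j then b else a)"
      have "x $ j = b" "x $ i = a"
        using e by (simp_all add: x_def)
      with sp \<open>a < b\<close> have "0 < (h b - h a) / \<phi> b a"
        unfolding strictly_passive_def res by (metis less_irrefl)
      with pos[OF \<open>a < b\<close>] show "h a < h b"
        by (simp add: zero_less_divide_iff)
    qed
  next
    assume mono: "strict_mono h"
    show "strictly_passive B w c \<phi> (energy c H) i j"
      unfolding strictly_passive_def res
    proof (intro allI impI)
      fix x :: "real ^ 'n"
      assume "x $ i \<noteq> x $ j"
      then consider "x $ i < x $ j" | "x $ j < x $ i"
        by linarith
      then show "0 < (h (x $ j) - h (x $ i)) / \<phi> (x $ j) (x $ i)"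
        by cases (simp_all add: pos neg strict_monoD[OF mono] zero_less_divide_iff)
    qed
  qed
qed

theorem proposition1:
  fixes B :: "('n::finite \<times> 'n) set"
    and w :: "'n \<times> 'n \<Rightarrow> real"
    and c :: "real ^ 'n"
    and \<phi> :: "real \<Rightarrow> real \<Rightarrow> real"
    and H h :: "real \<Rightarrow> real"
  assumes "CARD('n) \<ge> 2"
    and "weighted_strongly_connected B w"
    and "\<And>i. c $ i > 0"
    and "detailed_balance B w c"
    and "coupling_function \<phi>"
    and "\<And>x. (H has_real_derivative h x) (at x)"
    and "h C1_differentiable_on UNIV"
  shows "(\<forall>i j x. (j, i) \<in> B \<and> j \<noteq> i \<and> x $ i \<noteq> x $ j \<longrightarrow>
            edge_conductance B w c \<phi> (energy c H) i j x =
              c $ i * branch_weight B w i j * (\<phi> (x $ j) (x $ i) / (h (x $ j) - h (x $ i))))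
       \<and> ((\<forall>i j. (j, i) \<in> B \<and> j \<noteq> i \<longrightarrow> strictly_passive B w c \<phi> (energy c H) i j)
            \<longleftrightarrow> strictly_convex_on UNIV (energy c H))"
proof (intro conjI allI impI)
  fix i j and x :: "real ^ 'n"
  have "partial_derivative (energy c H) k (charge c x) = h (x $ k)" for k
    using assms(3)[of k] by (simp add: partial_derivative_energy[OF assms(3,6)] charge_def)
  then show "edge_conductance B w c \<phi> (energy c H) i j x =
      c $ i * branch_weight B w i j * (\<phi> (x $ j) (x $ i) / (h (x $ j) - h (x $ i)))"
    by (simp add: edge_conductance_def)
next
  have w: "\<And>e. e \<in> B \<Longrightarrow> w e > 0"
    and sc: "strongly_connected (with_proj \<lparr>pverts = UNIV, parcs = B\<rparr>)"
    using assms(2) by (auto simp: weighted_strongly_connected_def)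
  \<comment> \<open>Every proper resistor is subject to the same condition, independent of the edge
    and its weight.\<close>
  have edge: "strictly_passive B w c \<phi> (energy c H) i j \<longleftrightarrow> strict_mono h"
    if "(j, i) \<in> B" "j \<noteq> i" for i j
    using that by (intro strictly_passive_energy_iff assms w)
  \<comment> \<open>A proper branch must exist for passivity of all resistors to say anything about
    \<open>h\<close>; otherwise the condition would hold vacuously.\<close>
  obtain i j where "(j, i) \<in> B" "j \<noteq> i"
    using strongly_connected_imp_proper_branch[OF assms(1) sc] .
  then have "(\<forall>i j. (j, i) \<in> B \<and> j \<noteq> i \<longrightarrow> strictly_passive B w c \<phi> (energy c H) i j)
      \<longleftrightarrow> strict_mono h"
    using edge by blast
  then show "(\<forall>i j. (j, i) \<in> B \<and> j \<noteq> i \<longrightarrow> strictly_passive B w c \<phi> (energy c H) i j)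
      \<longleftrightarrow> strictly_convex_on UNIV (energy c H)"
    by (simp add: strictly_convex_energy_iff[OF assms(3)]
        strictly_convex_iff_strict_mono_deriv[OF assms(6)])
qed

end
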